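(* Let $Z\subset\mathbb{P}^n$ be a finite set and let $i\ge 0$ be an integer such that $Z$ satisfies the Cayley--Bacharach property $\mathit{CB}(i)$. Then for any integer $j$ with $0\le j\le i+1$ we have $$Dh_Z(0)+Dh_Z(1)+\cdots+Dh_Z(j)\ \le\ Dh_Z(i+1-j)+\cdots+Dh_Z(i+1).$$
   Context: $\mathbb{P}^n=\mathbb{P}^n_{\mathbb{C}}$ is complex projective space. Finite sets are sets of distinct (reduced) points. Hilbert function: for a finite set $Z\subset\mathbb{P}^n$ of cardinality $\ell(Z)$, choose a set $Y\subset\mathbb{C}^{n+1}$ consisting of one representative vector for each point of $Z$. For $j\ge 0$, $h_Z(j)$ is the rank of the evaluation map $S^j\mathbb{C}^{n+1}\to\mathbb{C}^{\ell(Z)}$ sending a form of degree $j$ in $n+1$ variables to its values at the points of $Y$ (this rank does not depend on the choice of $Y$); for $j<0$, $h_Z(j)=0$. The first difference is $Dh_Z(j)=h_Z(j)-h_Z(j-1)$ for $j\in\mathbb{Z}$. Cayley--Bacharach property in degree $i$, $\mathit{CB}(i)$: for every $P\in Z$, every form of degree $i$ vanishing at all points of $Z\setminus\{P\}$ also vanishes at $P$. *)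

theory Defs
  imports
    "HOL-Analysis.Cartesian_Space"
    "HOL-Library.Poly_Mapping"
    "HOL-Library.Function_Algebras"
begin

text \<open>
  The homogeneous coordinates are indexed by a finite type, so that \<open>'n proj\<close> is
  the complex projective space of dimension \<open>CARD('n) - 1\<close>; as all types are nonempty,
  every dimension \<open>\<ge> 0\<close> occurs.
\<close>

typedef (overloaded) 'n proj =
  "{L. \<exists>v :: complex ^ ('n::finite). v \<noteq> 0 \<and> L = vec.span {v}}"
  morphisms line Proj
proof
  show "vec.span {1} \<in> {L. \<exists>v :: complex ^ 'n. v \<noteq> 0 \<and> L = vec.span {v}}"
    by (auto intro: exI[of _ 1])
qed

definition represents :: "complex ^ 'n \<Rightarrow> ('n::finite) proj \<Rightarrow> bool" where
  "represents v P \<longleftrightarrow> v \<in> line P \<and> v \<noteq> 0"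

text \<open>
  Polynomials are finitely supported maps from exponent vectors to coefficients.
\<close>

type_synonym 'n cpoly = "('n \<Rightarrow>\<^sub>0 nat) \<Rightarrow>\<^sub>0 complex"

definition forms :: "nat \<Rightarrow> ('n::finite) cpoly set" where
  "forms d = {F. \<forall>m \<in> Poly_Mapping.keys F. (\<Sum>k\<in>UNIV. Poly_Mapping.lookup m k) = d}"

definition eval_poly :: "('n::finite) cpoly \<Rightarrow> complex ^ 'n \<Rightarrow> complex" where
  "eval_poly F v = (\<Sum>m\<in>Poly_Mapping.keys F.
     Poly_Mapping.lookup F m * (\<Prod>k\<in>UNIV. (v $ k) ^ Poly_Mapping.lookup m k))"

definition vanishes_at :: "('n::finite) cpoly \<Rightarrow> 'n proj \<Rightarrow> bool" where
  "vanishes_at F P \<longleftrightarrow> (\<forall>v. represents v P \<longrightarrow> eval_poly F v = 0)"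

definition cayley_bacharach :: "('n::finite) proj set \<Rightarrow> nat \<Rightarrow> bool" where
  "cayley_bacharach Z d \<longleftrightarrow>
     (\<forall>P\<in>Z. \<forall>F\<in>forms d. (\<forall>Q\<in>Z - {P}. vanishes_at F Q) \<longrightarrow> vanishes_at F P)"

global_interpretation cfun: vector_space "\<lambda>(c::complex) (f :: 'a \<Rightarrow> complex) x. c * f x"
  by unfold_locales (auto simp: fun_eq_iff algebra_simps)

text \<open>
  The space of complex families indexed by \<open>Z\<close> is realised as the space of functions on
  \<open>'n proj\<close> that are zero outside \<open>Z\<close>.
\<close>

definition eval_map ::
  "(('n::finite) proj \<Rightarrow> complex ^ 'n) \<Rightarrow> 'n proj set \<Rightarrow> 'n cpoly \<Rightarrow> 'n proj \<Rightarrow> complex" where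
  "eval_map r Z F = (\<lambda>P. if P \<in> Z then eval_poly F (r P) else 0)"

definition eval_rank ::
  "(('n::finite) proj \<Rightarrow> complex ^ 'n) \<Rightarrow> 'n proj set \<Rightarrow> nat \<Rightarrow> nat" where
  "eval_rank r Z d = cfun.dim (eval_map r Z ` forms d)"

definition hilbert :: "('n::finite) proj set \<Rightarrow> int \<Rightarrow> int" where
  "hilbert Z j =
     (if j < 0 then 0 else int (eval_rank (\<lambda>P. SOME v. represents v P) Z (nat j)))"

definition Dhilbert :: "('n::finite) proj set \<Rightarrow> int \<Rightarrow> int" where
  "Dhilbert Z j = hilbert Z j - hilbert Z (j - 1)"

lemma ex_represents: "\<exists>v. represents v (P :: ('n::finite) proj)"
proof -
  obtain v where "v \<noteq> 0" "line P = vec.span {v}"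
    using line[of P] by auto
  then show ?thesis
    unfolding represents_def using vec.span_base[of v "{v}"] by auto
qed

lemma represents_some: "represents (SOME v. represents v P) (P :: ('n::finite) proj)"
  using ex_represents by (rule someI_ex)

lemma represents_scale:
  assumes "represents v (P :: ('n::finite) proj)" "represents w P"
  shows "\<exists>c. c \<noteq> 0 \<and> w = c *s v"
proof -
  obtain u where u: "u \<noteq> 0" "line P = vec.span {u}"
    using line[of P] by auto
  obtain a b where ab: "v = a *s u" "w = b *s u"
    using assms u by (auto simp: represents_def vec.span_singleton)
  have nz: "a \<noteq> 0" "b \<noteq> 0"
    using assms ab by (auto simp: represents_def)
  then have "w = (b / a) *s v"
    using ab by (simp add: vec.scale_scale)
  then show ?thesis
    using nz by (intro exI[of _ "b / a"]) auto
qed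

lemma eval_poly_scale:
  assumes "F \<in> forms d"
  shows "eval_poly F (c *s v) = c ^ d * eval_poly F v"
proof -
  have "(\<Prod>k\<in>UNIV. ((c *s v) $ k) ^ Poly_Mapping.lookup m k) =
        c ^ d * (\<Prod>k\<in>UNIV. (v $ k) ^ Poly_Mapping.lookup m k)"
    if "m \<in> Poly_Mapping.keys F" for m
    using that assms
    by (auto simp: forms_def power_mult_distrib prod.distrib simp flip: power_sum)
  then show ?thesis
    unfolding eval_poly_def sum_distrib_left
    by (intro sum.cong) (auto simp: algebra_simps)
qed

lemma vanishes_at_iff:
  assumes "F \<in> forms d" "represents v P"
  shows "vanishes_at F P \<longleftrightarrow> eval_poly F v = 0"
proof
  assume "eval_poly F v = 0"
  then show "vanishes_at F P"
    unfolding vanishes_at_def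
    using represents_scale[OF assms(2)] eval_poly_scale[OF assms(1)] by fastforce
qed (use assms in \<open>auto simp: vanishes_at_def\<close>)

text \<open>The rank does not depend on the chosen representatives.\<close>

lemma eval_rank_le:
  assumes "finite Z"
    and r: "\<And>P. P \<in> Z \<Longrightarrow> represents (r P) (P :: ('n::finite) proj)"
    and s: "\<And>P. P \<in> Z \<Longrightarrow> represents (s P) P"
  shows "eval_rank r Z d \<le> eval_rank s Z d"
proof -
  have "\<forall>P\<in>Z. \<exists>c. r P = c *s s P"
    using represents_scale[OF s r] by blast
  then obtain c where c: "\<And>P. P \<in> Z \<Longrightarrow> r P = c P *s s P"
    by metis
  define T where "T = (\<lambda>(f :: 'n proj \<Rightarrow> complex) P. c P ^ d * f P)"
  have "vector_space (\<lambda>(c::complex) (f :: 'n proj \<Rightarrow> complex) x. c * f x)"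
    by (rule cfun.vector_space_axioms)
  then interpret T: Vector_Spaces.linear "\<lambda>(c::complex) f x. c * f x"
    "\<lambda>(c::complex) f x. c * f x" T
    unfolding Vector_Spaces.linear_iff by (auto simp: T_def fun_eq_iff algebra_simps)
  let ?S = "eval_map s Z ` forms d" and ?E = "(\<lambda>Q P. if P = Q then 1 else 0 :: complex) ` Z"
  have img: "eval_map r Z ` forms d = T ` ?S"
    unfolding image_image
    by (rule image_cong) (auto simp: eval_map_def T_def fun_eq_iff c eval_poly_scale)
  have "f \<in> cfun.span ?E" if "f \<in> ?S" for f
  proof -
    have sum_apply: "(\<Sum>Q\<in>A. g Q) P = (\<Sum>Q\<in>A. g Q P)"
      for A and g :: "'n proj \<Rightarrow> 'n proj \<Rightarrow> complex" and P
      by (induction A rule: infinite_finite_induct) auto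
    have "f = (\<Sum>Q\<in>Z. (\<lambda>P. f Q * (if P = Q then 1 else 0)))"
      using that assms(1)
      by (auto simp: fun_eq_iff sum_apply eval_map_def if_distrib sum.delta' cong: if_cong)
    also have "\<dots> \<in> cfun.span ?E"
      by (intro cfun.span_sum cfun.span_scale cfun.span_base) auto
    finally show ?thesis .
  qed
  then have sub: "?S \<subseteq> cfun.span ?E"
    by blast
  obtain B where B: "B \<subseteq> ?S" "cfun.independent B" "?S \<subseteq> cfun.span B" "card B = cfun.dim ?S"
    using cfun.basis_exists by blast
  have "finite B"
    using cfun.independent_span_bound[of ?E B] assms(1) B(1,2) sub by auto
  have "cfun.dim (T ` ?S) \<le> card (T ` B)"
    using B(3) \<open>finite B\<close> by (intro cfun.dim_le_card) (auto simp: T.span_image)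
  also have "\<dots> \<le> card B"
    using \<open>finite B\<close> by (rule card_image_le)
  finally show ?thesis
    by (simp add: eval_rank_def img B(4))
qed

lemma hilbert_eq_eval_rank:
  assumes "finite Z" "\<And>P. P \<in> Z \<Longrightarrow> represents (r P) (P :: ('n::finite) proj)"
  shows "hilbert Z (int d) = int (eval_rank r Z d)"
  using eval_rank_le[OF assms represents_some, of d]
    eval_rank_le[OF assms(1) represents_some assms(2), of d]
  by (simp add: hilbert_def)

end

theory Submission imports Defs begin

text \<open>
  The sums telescope, so with \<open>V\<^sub>d\<close> the space of functions on \<open>Z\<close> cut out by forms of degree
  \<open>d\<close>, and \<open>a + b = i\<close>, one has to show \<open>dim V\<^sub>a + dim V\<^sub>b \<le> dim V\<^bsub>i+1\<^esub>\<close>. This goes by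
  induction on the number of points.

  If \<open>CB(i+1)\<close> holds, remove any point \<open>P\<close>: no rank in degree \<open>\<le> i + 1\<close> changes, and
  \<open>CB(i)\<close> survives, because a form of degree \<open>i\<close> vanishing on \<open>Z - {P, Q}\<close> but not at
  \<open>Q\<close>, multiplied by a linear form through \<open>P\<close>, would violate \<open>CB(i+1)\<close> at \<open>Q\<close>.

  Otherwise let \<open>Z\<^sub>0 \<noteq> {}\<close> consist of the points whose indicator function lies in
  \<open>V\<^bsub>i+1\<^esub>\<close>. The induction hypothesis applies to \<open>Z\<^sub>1 = Z - Z\<^sub>0\<close>, and
  \<open>dim V\<^bsub>i+1\<^esub> = |Z\<^sub>0| + dim V\<^bsub>i+1\<^esub>(Z\<^sub>1)\<close>. It remains to bound by \<open>|Z\<^sub>0|\<close> the sum of the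
  dimensions of the kernels of \<open>V\<^sub>a \<rightarrow> V\<^sub>a(Z\<^sub>1)\<close> and \<open>V\<^sub>b \<rightarrow> V\<^sub>b(Z\<^sub>1)\<close>. By \<open>CB(i)\<close> some
  functional \<open>f \<mapsto> \<Sum>\<phi>\<^sub>P f(P)\<close> with all \<open>\<phi>\<^sub>P \<noteq> 0\<close> kills \<open>V\<^sub>i\<close>, so the kernels are
  orthogonal for the nondegenerate form \<open>\<Sum>\<phi>\<^sub>P f(P) g(P)\<close> on \<open>\<complex>\<^bsup>Z\<^sub>0\<^esup>\<close>.
\<close>

section \<open>Ranks of function spaces on finite sets\<close>

definition restr :: "'a set \<Rightarrow> ('a \<Rightarrow> complex) \<Rightarrow> 'a \<Rightarrow> complex" where
  "restr Z f = (\<lambda>P. if P \<in> Z then f P else 0)"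

definition rank_on :: "'a set \<Rightarrow> ('a \<Rightarrow> complex) set \<Rightarrow> nat" where
  "rank_on Z U = cfun.dim (restr Z ` U)"

text \<open>For a subspace \<open>U\<close> and finite sets of points, this is linear independence
  of the evaluations at \<open>B\<close> as functionals on \<open>U\<close>;
  \<open>determining\<close> below is the dual notion, that the evaluations at \<open>C\<close> span
  those at \<open>Z\<close>.\<close>

definition interpolating :: "('a \<Rightarrow> complex) set \<Rightarrow> 'a set \<Rightarrow> bool" where
  "interpolating U B \<longleftrightarrow> (\<forall>P\<in>B. \<exists>e\<in>U. \<forall>Q\<in>B. e Q = (if Q = P then 1 else 0))"

definition determining :: "'a set \<Rightarrow> ('a \<Rightarrow> complex) set \<Rightarrow> 'a set \<Rightarrow> bool" where
  "determining Z U C \<longleftrightarrow> (\<forall>f\<in>U. (\<forall>P\<in>C. f P = 0) \<longrightarrow> (\<forall>P\<in>Z. f P = 0))"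

lemma determiningD:
  assumes "determining Z U C" "f \<in> U" "\<And>P. P \<in> C \<Longrightarrow> f P = 0" "P \<in> Z"
  shows "f P = 0"
  using assms unfolding determining_def by simp

lemma sum_fun_apply: "(\<Sum>x\<in>A. g x) y = (\<Sum>x\<in>A. g x y)"
  for g :: "'b \<Rightarrow> 'a \<Rightarrow> complex"
  by (induction A rule: infinite_finite_induct) auto

lemma subspace_add: "cfun.subspace U \<Longrightarrow> f \<in> U \<Longrightarrow> g \<in> U \<Longrightarrow> (\<lambda>P. f P + g P) \<in> U"
  using cfun.subspace_add[of U f g] by (simp add: plus_fun_def)

lemma subspace_diff: "cfun.subspace U \<Longrightarrow> f \<in> U \<Longrightarrow> g \<in> U \<Longrightarrow> (\<lambda>P. f P - g P) \<in> U"
  using cfun.subspace_diff[of U f g] by (simp add: fun_diff_def)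

lemma subspace_scale: "cfun.subspace U \<Longrightarrow> f \<in> U \<Longrightarrow> (\<lambda>P. c * f P) \<in> U"
  by (rule cfun.subspace_scale)

lemma subspace_sum:
  "cfun.subspace U \<Longrightarrow> (\<And>x. x \<in> A \<Longrightarrow> g x \<in> U) \<Longrightarrow> (\<lambda>P. \<Sum>x\<in>A. g x P) \<in> U"
  using cfun.subspace_sum[of U A g] ext[of "sum g A" "\<lambda>P. \<Sum>x\<in>A. g x P"] sum_fun_apply[of g A]
  by metis

lemma interpolatingE:
  assumes "interpolating U B"
  obtains e where "\<And>P. P \<in> B \<Longrightarrow> e P \<in> U"
    and "\<And>P Q. P \<in> B \<Longrightarrow> Q \<in> B \<Longrightarrow> e P Q = (if Q = P then 1 else 0)"
proof -
  have "\<forall>P\<in>B. \<exists>e. e \<in> U \<and> (\<forall>Q\<in>B. e Q = (if Q = P then 1 else 0))"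
    using assms unfolding interpolating_def by blast
  then obtain e where "\<forall>P\<in>B. e P \<in> U \<and> (\<forall>Q\<in>B. e P Q = (if Q = P then 1 else 0))"
    by (auto dest!: bchoice)
  then show ?thesis
    by (intro that[of e]) auto
qed

text \<open>Lagrange interpolation: the two sides differ by a member of \<open>U\<close> that
  vanishes on \<open>B\<close>, hence on \<open>Z\<close>.\<close>

lemma interpolating_determining_expand:
  assumes "cfun.subspace U" "finite B" "determining Z U B"
    and "\<And>P. P \<in> B \<Longrightarrow> e P \<in> U"
    and "\<And>P Q. P \<in> B \<Longrightarrow> Q \<in> B \<Longrightarrow> e P Q = (if Q = P then 1 else 0)"
    and "f \<in> U" "R \<in> Z"
  shows "f R = (\<Sum>P\<in>B. f P * e P R)"
proof -
  let ?g = "\<lambda>R. f R - (\<Sum>P\<in>B. f P * e P R)"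
  have "?g \<in> U"
    using assms by (intro subspace_diff subspace_sum subspace_scale) auto
  moreover have "?g Q = 0" if "Q \<in> B" for Q
  proof -
    have "(\<Sum>P\<in>B. f P * e P Q) = (\<Sum>P\<in>B. if P = Q then f P else 0)"
      using that by (intro sum.cong) (auto simp: assms(5))
    then show ?thesis
      using that assms(2) by simp
  qed
  ultimately have "?g R = 0"
    using determiningD[OF assms(3), of ?g] assms(7) by blast
  then show ?thesis by simp
qed

text \<open>A linear relation between the \<open>e P\<close> on \<open>C\<close> persists on
  \<open>Z\<close>, where evaluation at \<open>P\<close> reads off its coefficients. An arbitrary
  \<open>C\<close> serves to compare cardinalities, \<open>C = Z\<close> to compute the
  rank.\<close>

lemma interpolating_independent:
  assumes "cfun.subspace U" "finite B" "B \<subseteq> Z" "determining Z U C"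
    and eU: "\<And>P. P \<in> B \<Longrightarrow> e P \<in> U"
    and e: "\<And>P Q. P \<in> B \<Longrightarrow> Q \<in> B \<Longrightarrow> e P Q = (if Q = P then 1 else 0)"
  shows "inj_on (\<lambda>P. restr C (e P)) B" "cfun.independent ((\<lambda>P. restr C (e P)) ` B)"
proof -
  have zero: "c P = 0"
    if sum0: "(\<Sum>P\<in>B. (\<lambda>Q. c P * restr C (e P) Q)) = 0" and P: "P \<in> B" for c P
  proof -
    let ?g = "\<lambda>Q. \<Sum>P\<in>B. c P * e P Q"
    have "?g P = 0"
    proof (rule determiningD[OF assms(4), of ?g])
      show "?g \<in> U"
        using eU by (intro subspace_sum subspace_scale assms(1)) auto
      show "?g Q = 0" if "Q \<in> C" for Q
        using fun_cong[OF sum0, of Q] that by (simp add: sum_fun_apply restr_def)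
      show "P \<in> Z" using P assms(3) by blast
    qed
    moreover have "?g P = (\<Sum>Q\<in>B. if Q = P then c Q else 0)"
      using P by (intro sum.cong) (auto simp: e)
    ultimately show ?thesis
      using assms(2) P by simp
  qed
  show inj: "inj_on (\<lambda>P. restr C (e P)) B"
  proof (rule inj_onI)
    fix P Q assume PQ: "P \<in> B" "Q \<in> B" "restr C (e P) = restr C (e Q)"
    \<comment> \<open>Two equal restrictions would give a relation with coefficients 1 and -1, which
      \<open>zero\<close> forbids for \<open>P \<noteq> Q\<close>.\<close>
    let ?c = "\<lambda>R. (if R = P then 1 else 0) - (if R = Q then 1 else 0 :: complex)"
    have "(\<Sum>R\<in>B. (\<lambda>S. ?c R * restr C (e R) S)) S = restr C (e P) S - restr C (e Q) S" for S
    proof -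
      have "(\<Sum>R\<in>B. ?c R * restr C (e R) S) =
          (\<Sum>R\<in>B. (if R = P then restr C (e R) S else 0) - (if R = Q then restr C (e R) S else 0))"
        by (intro sum.cong) auto
      then show ?thesis
        using PQ(1,2) assms(2) by (simp add: sum_fun_apply sum_subtractf)
    qed
    then have "(\<Sum>R\<in>B. (\<lambda>S. ?c R * restr C (e R) S)) = 0"
      using PQ(3) by (auto simp: fun_eq_iff)
    from zero[OF this PQ(1)] show "P = Q"
      by (auto split: if_splits)
  qed
  show "cfun.independent ((\<lambda>P. restr C (e P)) ` B)"
  proof (rule cfun.independent_if_scalars_zero)
    fix c v assume c: "(\<Sum>v\<in>(\<lambda>P. restr C (e P)) ` B. (\<lambda>x. c v * v x)) = 0"
      and v: "v \<in> (\<lambda>P. restr C (e P)) ` B"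
    then obtain P where P: "P \<in> B" "v = restr C (e P)" by auto
    show "c v = 0"
      using zero[of "\<lambda>P. c (restr C (e P))", OF _ P(1)] c P(2)
      by (simp add: sum.reindex[OF inj])
  qed (use assms in auto)
qed

lemma restr_in_span:
  assumes "finite Z"
  shows "restr Z f \<in> cfun.span ((\<lambda>Q P. if P = Q then 1 else 0) ` Z)"
proof -
  have "restr Z f = (\<Sum>Q\<in>Z. (\<lambda>P. f Q * (if P = Q then 1 else 0)))"
    using assms
    by (auto simp: fun_eq_iff sum_fun_apply restr_def if_distrib sum.delta' cong: if_cong)
  also have "\<dots> \<in> cfun.span ((\<lambda>Q P. if P = Q then 1 else 0) ` Z)"
    by (intro cfun.span_sum cfun.span_scale cfun.span_base) auto
  finally show ?thesis .
qed

text \<open>Restricted to \<open>C\<close>, the Lagrange functions of \<open>B\<close> are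
  independent vectors in a space spanned by the indicators of the points of
  \<open>C\<close>.\<close>

lemma interpolating_le_determining:
  assumes "cfun.subspace U" "finite B" "B \<subseteq> Z" "interpolating U B"
    and "finite C" "determining Z U C"
  shows "card B \<le> card C"
proof -
  obtain e where eU: "\<And>P. P \<in> B \<Longrightarrow> e P \<in> U"
    and e: "\<And>P Q. P \<in> B \<Longrightarrow> Q \<in> B \<Longrightarrow> e P Q = (if Q = P then 1 else 0)"
    using interpolatingE[OF assms(4)] by metis
  note ind = interpolating_independent[OF assms(1-3,6) eU e]
  let ?E = "(\<lambda>Q P. if P = Q then 1 else 0 :: complex) ` C"
  have "card B = card ((\<lambda>P. restr C (e P)) ` B)"
    using card_image[OF ind(1)] by simp
  also have "\<dots> \<le> card ?E"
    using cfun.independent_span_bound[OF _ ind(2), of ?E] restr_in_span[OF assms(5)] assms(5)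
    by auto
  also have "\<dots> \<le> card C"
    using assms(5) by (rule card_image_le)
  finally show ?thesis .
qed

lemma ex_interpolating_determining:
  assumes "cfun.subspace U" "finite Z"
  obtains B where "B \<subseteq> Z" "interpolating U B" "determining Z U B"
proof -
  define \<B> where "\<B> = {B. B \<subseteq> Z \<and> interpolating U B}"
  have "finite \<B>" "{} \<in> \<B>"
    using assms(2) by (auto simp: \<B>_def interpolating_def)
  then obtain B where B: "B \<in> \<B>" and max: "\<And>B'. B' \<in> \<B> \<Longrightarrow> B \<subseteq> B' \<Longrightarrow> B = B'"
    using finite_has_maximal[of \<B>] by blast
  \<comment> \<open>A function vanishing on \<open>B\<close> but not at \<open>R\<close> would allow
    \<open>R\<close> to be added to the maximal set \<open>B\<close>.\<close>
  have "determining Z U B"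
    unfolding determining_def
  proof (intro ballI impI, rule ccontr)
    fix f R assume f: "f \<in> U" "\<forall>P\<in>B. f P = 0" and R: "R \<in> Z" "f R \<noteq> 0"
    have "R \<notin> B" using f R by auto
    obtain e where eU: "\<And>P. P \<in> B \<Longrightarrow> e P \<in> U"
      and e: "\<And>P Q. P \<in> B \<Longrightarrow> Q \<in> B \<Longrightarrow> e P Q = (if Q = P then 1 else 0)"
      using interpolatingE[of U B] B unfolding \<B>_def by auto
    have "interpolating U (insert R B)"
      unfolding interpolating_def
    proof
      fix P assume P: "P \<in> insert R B"
      \<comment> \<open>For \<open>P = R\<close>, normalise \<open>f\<close>; otherwise clear the
        value of \<open>e P\<close> at \<open>R\<close> by a multiple of \<open>f\<close>, which
        does not disturb the values on \<open>B\<close>.\<close>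
      define g where "g = (if P = R then (\<lambda>Q. (1 / f R) * f Q)
        else (\<lambda>Q. e P Q - (e P R / f R) * f Q))"
      have "g \<in> U"
        using P f eU assms(1) unfolding g_def
        by (auto intro!: subspace_scale subspace_diff simp del: times_divide_eq_left)
      moreover have "\<forall>Q\<in>insert R B. g Q = (if Q = P then 1 else 0)"
        using P f(2) R(2) e \<open>R \<notin> B\<close> by (auto simp: g_def)
      ultimately show "\<exists>g\<in>U. \<forall>Q\<in>insert R B. g Q = (if Q = P then 1 else 0)" by blast
    qed
    then have "insert R B \<in> \<B>"
      using B R(1) by (auto simp: \<B>_def)
    with max \<open>R \<notin> B\<close> show False by blast
  qed
  then show ?thesis
    using that B by (auto simp: \<B>_def)
qed

section \<open>Ranks counted by points\<close>

lemma rank_on_eq_card: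
  assumes "cfun.subspace U" "finite Z" "B \<subseteq> Z" "interpolating U B" "determining Z U B"
  shows "rank_on Z U = card B"
proof -
  have fin: "finite B" using assms(2,3) finite_subset by blast
  obtain e where eU: "\<And>P. P \<in> B \<Longrightarrow> e P \<in> U"
    and e: "\<And>P Q. P \<in> B \<Longrightarrow> Q \<in> B \<Longrightarrow> e P Q = (if Q = P then 1 else 0)"
    using interpolatingE[OF assms(4)] by metis
  have "determining Z U Z" by (auto simp: determining_def)
  note ind = interpolating_independent[OF assms(1) fin assms(3) this eU e]
  have "restr Z f \<in> cfun.span ((\<lambda>P. restr Z (e P)) ` B)" if "f \<in> U" for f
  proof -
    have "restr Z f = (\<Sum>P\<in>B. (\<lambda>Q. f P * restr Z (e P) Q))"
      using interpolating_determining_expand[OF assms(1) fin assms(5) eU e that]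
      by (auto simp: fun_eq_iff sum_fun_apply restr_def)
    also have "\<dots> \<in> cfun.span ((\<lambda>P. restr Z (e P)) ` B)"
      by (intro cfun.span_sum cfun.span_scale cfun.span_base) auto
    finally show ?thesis .
  qed
  then have "cfun.dim (restr Z ` U) = card ((\<lambda>P. restr Z (e P)) ` B)"
    using eU ind(2) by (intro cfun.dim_unique) auto
  then show ?thesis
    unfolding rank_on_def using card_image[OF ind(1)] by simp
qed

lemma rank_on_basis:
  assumes "cfun.subspace U" "finite Z"
  obtains B where "B \<subseteq> Z" "finite B" "interpolating U B" "determining Z U B"
    "rank_on Z U = card B"
  using ex_interpolating_determining[OF assms] rank_on_eq_card[OF assms] finite_subset assms(2)
  by metis

text \<open>From here on, ranks are bounded above by exhibiting determining sets and below by
  exhibiting interpolating sets.\<close>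

lemma rank_on_le:
  assumes "cfun.subspace U" "finite Z" "finite C" "determining Z U C"
  shows "rank_on Z U \<le> card C"
  using rank_on_basis[OF assms(1,2)] interpolating_le_determining[OF assms(1) _ _ _ assms(3,4)]
  by metis

lemma rank_on_ge:
  assumes "cfun.subspace U" "finite Z" "B \<subseteq> Z" "interpolating U B"
  shows "card B \<le> rank_on Z U"
  using rank_on_basis[OF assms(1,2)]
    interpolating_le_determining[OF assms(1) finite_subset[OF assms(3,2)] assms(3,4)]
  by metis

lemma rank_on_mono:
  assumes "cfun.subspace U" "finite Z" "Y \<subseteq> Z"
  shows "rank_on Y U \<le> rank_on Z U"
  using rank_on_basis[OF assms(1) finite_subset[OF assms(3,2)]] rank_on_ge[OF assms(1,2)] assms(3)
  by (metis subset_trans)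

text \<open>The next lemma is the bound \<open>dim U + dim U\<^sup>\<bottom> \<le> |S|\<close> for the weighted bilinear form.\<close>

lemma rank_on_orthogonal:
  assumes "cfun.subspace U" "cfun.subspace V" "finite S"
    and \<phi>: "\<And>P. P \<in> S \<Longrightarrow> \<phi> P \<noteq> 0"
    and orth: "\<And>f g. f \<in> U \<Longrightarrow> g \<in> V \<Longrightarrow> (\<Sum>P\<in>S. \<phi> P * f P * g P) = 0"
  shows "rank_on S U + rank_on S V \<le> card S"
proof -
  obtain B where B: "B \<subseteq> S" "finite B" "interpolating U B" "rank_on S U = card B"
    using rank_on_basis[OF assms(1,3)] by metis
  obtain e where eU: "\<And>P. P \<in> B \<Longrightarrow> e P \<in> U"
    and e: "\<And>P Q. P \<in> B \<Longrightarrow> Q \<in> B \<Longrightarrow> e P Q = (if Q = P then 1 else 0)"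
    using interpolatingE[OF B(3)] by metis
  \<comment> \<open>Pairing \<open>e P\<close> with a \<open>g\<close> that vanishes off
    \<open>B\<close> leaves only the term \<open>\<phi> P * g P\<close>.\<close>
  have "determining S V (S - B)"
    unfolding determining_def
  proof (intro ballI impI)
    fix g P assume g: "g \<in> V" "\<forall>P\<in>S - B. g P = 0" and P: "P \<in> S"
    show "g P = 0"
    proof (cases "P \<in> B")
      case True
      have "0 = (\<Sum>Q\<in>S. \<phi> Q * e P Q * g Q)"
        using orth[OF eU[OF True] g(1)] by simp
      also have "\<dots> = (\<Sum>Q\<in>S. if Q = P then \<phi> P * g P else 0)"
        using g(2) e[OF True] True by (intro sum.cong refl) (case_tac "x \<in> B"; auto)
      finally show ?thesis
        using assms(3) P \<phi>[OF P] by simp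
    qed (use g P in auto)
  qed
  then have "rank_on S V \<le> card (S - B)"
    using assms by (intro rank_on_le) auto
  moreover have "card (S - B) = card S - card B" "card B \<le> card S"
    using B assms(3) by (auto simp: card_Diff_subset card_mono)
  ultimately show ?thesis
    using B(4) by linarith
qed

section \<open>Nowhere vanishing annihilators\<close>

lemma ex_nowhere_zero:
  assumes "cfun.subspace N" "finite Z" "\<And>P. P \<in> Z \<Longrightarrow> \<exists>\<phi>\<in>N. \<phi> P \<noteq> 0"
  shows "\<exists>\<phi>\<in>N. \<forall>P\<in>Z. \<phi> P \<noteq> 0"
  using assms(2,3)
proof (induction Z)
  case empty
  then show ?case using cfun.subspace_0[OF assms(1)] by auto
next
  case (insert P Z)
  have "\<exists>\<phi>\<in>N. \<forall>Q\<in>Z. \<phi> Q \<noteq> 0"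
    by (intro insert.IH insert.prems) simp
  then obtain \<phi> where \<phi>: "\<phi> \<in> N" "\<forall>Q\<in>Z. \<phi> Q \<noteq> 0" ..
  obtain \<psi> where \<psi>: "\<psi> \<in> N" "\<psi> P \<noteq> 0"
    using insert.prems[of P] by auto
  \<comment> \<open>Where \<open>\<phi> Q \<noteq> 0\<close>, the quotient is the one
    \<open>t\<close> with \<open>\<psi> Q + t * \<phi> Q = 0\<close>. Only at \<open>Q = P\<close>
    can \<open>\<phi> Q\<close> be 0, and there \<open>\<psi> P \<noteq> 0\<close> suffices.\<close>
  have "finite ((\<lambda>Q. - \<psi> Q / \<phi> Q) ` insert P Z \<union> {0})"
    using insert.hyps by auto
  then obtain t where t: "t \<notin> (\<lambda>Q. - \<psi> Q / \<phi> Q) ` insert P Z \<union> {0}"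
    using ex_new_if_finite[OF infinite_UNIV_char_0] by blast
  have "\<psi> Q + t * \<phi> Q \<noteq> 0" if "Q \<in> insert P Z" for Q
  proof (cases "\<phi> Q = 0")
    case True
    then show ?thesis using that \<phi>(2) \<psi>(2) by auto
  next
    case False
    have "t \<noteq> - \<psi> Q / \<phi> Q" using t that by blast
    then show ?thesis using False by (auto simp: field_simps add_eq_0_iff)
  qed
  moreover have "(\<lambda>Q. \<psi> Q + t * \<phi> Q) \<in> N"
    using \<phi>(1) \<psi>(1) assms(1) by (intro subspace_add subspace_scale)
  ultimately show ?case by (intro bexI) auto
qed

text \<open>For a subspace \<open>U\<close>: no indicator function of a point of \<open>Z\<close> is
  the restriction of a member of \<open>U\<close>.\<close>

definition cb_on :: "'a set \<Rightarrow> ('a \<Rightarrow> complex) set \<Rightarrow> bool" where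
  "cb_on Z U \<longleftrightarrow> (\<forall>P\<in>Z. \<forall>f\<in>U. (\<forall>Q\<in>Z - {P}. f Q = 0) \<longrightarrow> f P = 0)"

lemma cb_onD:
  assumes "cb_on Z U" "f \<in> U" "P \<in> Z" "\<And>Q. Q \<in> Z \<Longrightarrow> Q \<noteq> P \<Longrightarrow> f Q = 0"
  shows "f P = 0"
  using assms unfolding cb_on_def by simp

lemma cb_on_nowhere_zero_annihilator:
  assumes U: "cfun.subspace U" and fin: "finite Z" and cb: "cb_on Z U"
  obtains \<phi> where "\<And>P. P \<in> Z \<Longrightarrow> \<phi> P \<noteq> 0" "\<And>f. f \<in> U \<Longrightarrow> (\<Sum>P\<in>Z. \<phi> P * f P) = 0"
proof -
  define N where "N = {\<phi>. \<forall>f\<in>U. (\<Sum>P\<in>Z. \<phi> P * f P) = 0}"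
  have N: "cfun.subspace N"
    unfolding N_def cfun.subspace_def
    by (auto simp: distrib_right sum.distrib mult.assoc simp flip: sum_distrib_left)
  obtain B where B: "B \<subseteq> Z" "finite B" "interpolating U B" "determining Z U B"
    using rank_on_basis[OF U fin] by metis
  obtain e where eU: "\<And>P. P \<in> B \<Longrightarrow> e P \<in> U"
    and e: "\<And>P Q. P \<in> B \<Longrightarrow> Q \<in> B \<Longrightarrow> e P Q = (if Q = P then 1 else 0)"
    using interpolatingE[OF B(3)] by metis
  \<comment> \<open>For \<open>R \<notin> B\<close>, the relation \<open>f R = (\<Sum>P\<in>B. f P * e P R)\<close> is an annihilator of \<open>U\<close>.\<close>
  define \<psi> where "\<psi> R = (\<lambda>P. if P \<in> B then - e P R else if P = R then 1 else 0)" for R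
  have \<psi>: "\<psi> R \<in> N" if R: "R \<in> Z - B" for R
    unfolding N_def
  proof safe
    fix f assume f: "f \<in> U"
    have "(\<Sum>P\<in>Z. \<psi> R P * f P) = (\<Sum>P\<in>B. \<psi> R P * f P) + (\<Sum>P\<in>Z - B. \<psi> R P * f P)"
      using B(1) fin by (metis add.commute sum.subset_diff)
    also have "(\<Sum>P\<in>B. \<psi> R P * f P) = - (\<Sum>P\<in>B. f P * e P R)"
      by (simp add: \<psi>_def sum_negf mult.commute)
    also have "(\<Sum>P\<in>Z - B. \<psi> R P * f P) = (\<Sum>P\<in>Z - B. if P = R then f R else 0)"
      by (intro sum.cong) (auto simp: \<psi>_def)
    also have "\<dots> = f R"
      using R fin by simp
    finally show "(\<Sum>P\<in>Z. \<psi> R P * f P) = 0"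
      using interpolating_determining_expand[OF U B(2,4) eU e f, of R] R by simp
  qed
  have "\<exists>\<phi>\<in>N. \<phi> P \<noteq> 0" if P: "P \<in> Z" for P
  proof (cases "P \<in> B")
    case True
    \<comment> \<open>\<open>e P\<close> is zero on the rest of \<open>B\<close>; if it were zero on
      \<open>Z - B\<close> as well, it would be the indicator of \<open>P\<close> on
      \<open>Z\<close>.\<close>
    have "\<exists>R\<in>Z - B. e P R \<noteq> 0"
    proof (rule ccontr)
      assume "\<not> ?thesis"
      then have "e P Q = 0" if "Q \<in> Z" "Q \<noteq> P" for Q
        using e[OF True, of Q] that by (cases "Q \<in> B") auto
      then have "e P P = 0"
        using cb_onD[OF cb eU[OF True] P] by blast
      then show False using e[OF True True] by simp
    qed
    then obtain R where R: "R \<in> Z - B" "e P R \<noteq> 0" ..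
    then have "\<psi> R P \<noteq> 0" using True by (simp add: \<psi>_def)
    then show ?thesis using \<psi>[OF R(1)] by blast
  next
    case False
    then have "\<psi> P P \<noteq> 0" by (simp add: \<psi>_def)
    then show ?thesis using \<psi>[of P] P False by blast
  qed
  from ex_nowhere_zero[OF N fin this] obtain \<phi> where "\<phi> \<in> N" "\<forall>P\<in>Z. \<phi> P \<noteq> 0"
    by blast
  then show ?thesis
    using that unfolding N_def by blast
qed

section \<open>Graded algebras of functions separating points\<close>

text \<open>What is retained of the homogeneous coordinate ring: graded products and enough linear
  forms. The members of \<open>W d\<close> model forms of degree \<open>d\<close> evaluated at fixed
  representatives.\<close>

locale graded_functions =
  fixes W :: "nat \<Rightarrow> ('a \<Rightarrow> complex) set"
  assumes subspace: "cfun.subspace (W d)"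
    and mult: "f \<in> W a \<Longrightarrow> g \<in> W b \<Longrightarrow> (\<lambda>P. f P * g P) \<in> W (a + b)"
    and nonvanishing: "\<exists>l\<in>W 1. l P \<noteq> 0"
    and separating: "P \<noteq> Q \<Longrightarrow> \<exists>l\<in>W 1. l P \<noteq> 0 \<and> l Q = 0"
begin

section \<open>Cayley-Bacharach in lower degrees and on smaller sets\<close>

lemma cb_on_Suc:
  assumes "cb_on Z (W (Suc d))"
  shows "cb_on Z (W d)"
  unfolding cb_on_def
proof (intro ballI impI)
  fix P f assume P: "P \<in> Z" and f: "f \<in> W d" "\<forall>Q\<in>Z - {P}. f Q = 0"
  obtain l where l: "l \<in> W 1" "l P \<noteq> 0" using nonvanishing by blast
  have "(\<lambda>P. f P * l P) \<in> W (Suc d)" using mult[OF f(1) l(1)] by simp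
  then have "f P * l P = 0"
    by (rule cb_onD[OF assms _ P]) (use f(2) in auto)
  with l show "f P = 0" by simp
qed

lemma cb_on_le:
  assumes "d \<le> e" "cb_on Z (W e)"
  shows "cb_on Z (W d)"
  using assms by (induction rule: inc_induct) (auto intro: cb_on_Suc)

lemma cb_on_remove_point:
  assumes "cb_on Z (W (Suc d))" "P \<in> Z"
  shows "cb_on (Z - {P}) (W d)"
  unfolding cb_on_def
proof (intro ballI impI)
  fix Q f assume Q: "Q \<in> Z - {P}" and f: "f \<in> W d" "\<forall>R\<in>Z - {P} - {Q}. f R = 0"
  obtain l where l: "l \<in> W 1" "l Q \<noteq> 0" "l P = 0" using separating[of Q P] Q by blast
  have "(\<lambda>P. f P * l P) \<in> W (Suc d)" using mult[OF f(1) l(1)] by simp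
  \<comment> \<open>Nothing is known about \<open>f\<close> at the removed point \<open>P\<close>;
    there \<open>l\<close> supplies the zero.\<close>
  moreover have "f R * l R = 0" if "R \<in> Z" "R \<noteq> Q" for R
    using f(2) l(3) that by (cases "R = P") auto
  ultimately have "f Q * l Q = 0"
    using cb_onD[OF assms(1), of "\<lambda>P. f P * l P" Q] Q by blast
  with l show "f Q = 0" by simp
qed

text \<open>By Cayley-Bacharach, whatever determines \<open>Z - {P}\<close> determines
  \<open>Z\<close>.\<close>

lemma rank_on_remove_point:
  assumes "finite Z" "cb_on Z (W d)" "P \<in> Z"
  shows "rank_on Z (W d) \<le> rank_on (Z - {P}) (W d)"
proof -
  obtain B where B: "finite B" "determining (Z - {P}) (W d) B"
    "rank_on (Z - {P}) (W d) = card B"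
    using rank_on_basis[OF subspace, of "Z - {P}" d] assms(1) by auto
  have "determining Z (W d) B"
    using B(2) assms(2,3) unfolding determining_def cb_on_def by blast
  then show ?thesis
    using rank_on_le[OF subspace assms(1) B(1)] B(3) by simp
qed

section \<open>Restriction kernels and points with indicators\<close>

lemma rank_on_le_kernel:
  assumes "finite Z" "Y \<subseteq> Z"
  shows "rank_on Z (W d) \<le>
    rank_on Y (W d) + rank_on (Z - Y) {f \<in> W d. \<forall>P\<in>Y. f P = 0}"
    and "cfun.subspace {f \<in> W d. \<forall>P\<in>Y. f P = 0}"
proof -
  let ?K = "{f \<in> W d. \<forall>P\<in>Y. f P = 0}"
  show K: "cfun.subspace ?K"
    using subspace[of d] by (auto simp: cfun.subspace_def)
  obtain B where B: "finite B" "determining Y (W d) B" "rank_on Y (W d) = card B"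
    using rank_on_basis[OF subspace finite_subset[OF assms(2,1)], of d] by metis
  obtain C where C: "finite C" "determining (Z - Y) ?K C" "rank_on (Z - Y) ?K = card C"
    using rank_on_basis[OF K, of "Z - Y"] assms(1) by auto
  \<comment> \<open>Rank-nullity for restriction to \<open>Y\<close>: vanishing on \<open>B\<close>
    puts a function into the kernel \<open>?K\<close>, and vanishing on \<open>C\<close> then kills
    it on \<open>Z - Y\<close>.\<close>
  have "determining Z (W d) (B \<union> C)"
    using B(2) C(2) unfolding determining_def by blast
  then have "rank_on Z (W d) \<le> card (B \<union> C)"
    using B(1) C(1) by (intro rank_on_le subspace assms) auto
  then show "rank_on Z (W d) \<le> rank_on Y (W d) + rank_on (Z - Y) ?K"
    using card_Un_le[of B C] B(3) C(3) by linarith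
qed

lemma split_off_indicators:
  fixes Z d
  defines "Z0 \<equiv> {P \<in> Z. \<exists>f\<in>W d. (\<forall>Q\<in>Z - {P}. f Q = 0) \<and> f P \<noteq> 0}"
  assumes fin: "finite Z"
  shows "cb_on (Z - Z0) (W d)"
    and "card Z0 + rank_on (Z - Z0) (W d) \<le> rank_on Z (W d)"
proof -
  have "\<forall>P\<in>Z0. \<exists>e. e \<in> W d \<and> (\<forall>Q\<in>Z. e Q = (if Q = P then 1 else 0))"
  proof
    fix P assume "P \<in> Z0"
    then obtain f where f: "f \<in> W d" "\<forall>Q\<in>Z - {P}. f Q = 0" "f P \<noteq> 0"
      unfolding Z0_def by blast
    then show "\<exists>e. e \<in> W d \<and> (\<forall>Q\<in>Z. e Q = (if Q = P then 1 else 0))"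
      by (intro exI[of _ "\<lambda>Q. (1 / f P) * f Q"] conjI subspace_scale[OF subspace]) auto
  qed
  then obtain e where e: "\<And>P. P \<in> Z0 \<Longrightarrow> e P \<in> W d"
    "\<And>P Q. P \<in> Z0 \<Longrightarrow> Q \<in> Z \<Longrightarrow> e P Q = (if Q = P then 1 else 0)"
    by (metis (no_types, lifting))
  have sub: "Z0 \<subseteq> Z" and fin0: "finite Z0"
    using fin by (auto simp: Z0_def)
  \<comment> \<open>Subtracting indicators clears the values on \<open>Z0\<close> without changing
    those on \<open>Z - Z0\<close>.\<close>
  have clear: "\<exists>g\<in>W d. \<forall>Q\<in>Z. g Q = (if Q \<in> Z0 then 0 else f Q)" if "f \<in> W d" for f
  proof (intro bexI ballI)
    let ?g = "\<lambda>Q. f Q - (\<Sum>P\<in>Z0. f P * e P Q)"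
    show "?g \<in> W d"
      using that e(1) by (intro subspace_diff subspace_sum subspace_scale subspace) auto
    fix Q assume Q: "Q \<in> Z"
    have "(\<Sum>P\<in>Z0. f P * e P Q) = (\<Sum>P\<in>Z0. if P = Q then f Q else 0)"
      using e(2) Q by (intro sum.cong) auto
    then show "?g Q = (if Q \<in> Z0 then 0 else f Q)"
      using fin0 by simp
  qed
  show "cb_on (Z - Z0) (W d)"
    unfolding cb_on_def
  proof (intro ballI impI)
    fix P f assume P: "P \<in> Z - Z0" and f: "f \<in> W d" "\<forall>Q\<in>Z - Z0 - {P}. f Q = 0"
    obtain g where g: "g \<in> W d" "\<forall>Q\<in>Z. g Q = (if Q \<in> Z0 then 0 else f Q)"
      using clear[OF f(1)] by blast
    \<comment> \<open>If \<open>g P\<close> were nonzero, \<open>g\<close> would put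
      \<open>P\<close> into \<open>Z0\<close>.\<close>
    have "\<forall>Q\<in>Z - {P}. g Q = 0" using g(2) f(2) by auto
    then have "g P = 0" using P g(1) unfolding Z0_def by auto
    then show "f P = 0" using g(2) P by simp
  qed
  obtain B where B: "B \<subseteq> Z - Z0" "finite B" "interpolating (W d) B"
    "rank_on (Z - Z0) (W d) = card B"
    using rank_on_basis[OF subspace, of "Z - Z0" d] fin by auto
  \<comment> \<open>The indicators serve the points of \<open>Z0\<close>, the cleared interpolating
    functions those of \<open>B\<close>.\<close>
  have "interpolating (W d) (Z0 \<union> B)"
    unfolding interpolating_def
  proof
    fix P assume "P \<in> Z0 \<union> B"
    then show "\<exists>g\<in>W d. \<forall>Q\<in>Z0 \<union> B. g Q = (if Q = P then 1 else 0)"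
    proof
      assume "P \<in> Z0"
      then show ?thesis using e B(1) sub by (intro bexI[of _ "e P"]) auto
    next
      assume P: "P \<in> B"
      then obtain f where f: "f \<in> W d" "\<forall>Q\<in>B. f Q = (if Q = P then 1 else 0)"
        using B(3) unfolding interpolating_def by blast
      obtain g where g: "g \<in> W d" "\<forall>Q\<in>Z. g Q = (if Q \<in> Z0 then 0 else f Q)"
        using clear[OF f(1)] by blast
      show ?thesis using g f(2) P B(1) sub by (intro bexI[of _ g]) auto
    qed
  qed
  then have "card (Z0 \<union> B) \<le> rank_on Z (W d)"
    using B(1) sub by (intro rank_on_ge subspace fin) auto
  moreover have "card (Z0 \<union> B) = card Z0 + card B"
    using B fin0 by (intro card_Un_disjoint) auto
  ultimately show "card Z0 + rank_on (Z - Z0) (W d) \<le> rank_on Z (W d)"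
    using B(4) by simp
qed

section \<open>The rank inequality\<close>

theorem cb_on_rank_add_le:
  assumes "finite Z" "cb_on Z (W (a + b))"
  shows "rank_on Z (W a) + rank_on Z (W b) \<le> rank_on Z (W (Suc (a + b)))"
  using assms
proof (induction "card Z" arbitrary: Z rule: less_induct)
  case less
  note fin = less.prems(1) and cb = less.prems(2)
  consider "Z = {}" | P where "P \<in> Z" "cb_on Z (W (Suc (a + b)))" | "\<not> cb_on Z (W (Suc (a + b)))"
    by blast
  then show ?case
  proof cases
    case 1
    have "rank_on {} (W d) \<le> card ({} :: 'a set)" for d
      by (intro rank_on_le subspace) (auto simp: determining_def)
    then show ?thesis using 1 by simp
  next
    case (2 P)
    have "card (Z - {P}) < card Z"
      using fin 2(1) by (intro psubset_card_mono) auto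
    then have "rank_on (Z - {P}) (W a) + rank_on (Z - {P}) (W b) \<le>
        rank_on (Z - {P}) (W (Suc (a + b)))"
      using less.hyps cb_on_remove_point[OF 2(2,1)] fin by simp
    \<comment> \<open>In degrees \<open>a\<close> and \<open>b\<close> no rank is lost, since
      Cayley-Bacharach descends from \<open>a + b\<close>; in the top degree monotonicity points the
      right way.\<close>
    moreover have "rank_on Z (W a) \<le> rank_on (Z - {P}) (W a)"
      "rank_on Z (W b) \<le> rank_on (Z - {P}) (W b)"
      using fin cb 2(1) by (auto intro!: rank_on_remove_point cb_on_le[of _ "a + b"])
    moreover have "rank_on (Z - {P}) (W (Suc (a + b))) \<le> rank_on Z (W (Suc (a + b)))"
      by (intro rank_on_mono subspace fin) auto
    ultimately show ?thesis by linarith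
  next
    case 3
    define Z0 where
      "Z0 = {P \<in> Z. \<exists>f\<in>W (Suc (a + b)). (\<forall>Q\<in>Z - {P}. f Q = 0) \<and> f P \<noteq> 0}"
    define K where "K d = {f \<in> W d. \<forall>P\<in>Z - Z0. f P = 0}" for d
    note split = split_off_indicators[OF fin, of "Suc (a + b)", folded Z0_def]
    have Z0: "Z0 \<subseteq> Z" "Z0 \<noteq> {}" "finite Z0" "Z - (Z - Z0) = Z0"
      using 3 fin by (auto simp: Z0_def cb_on_def)
    have "card (Z - Z0) < card Z"
      using fin Z0 by (intro psubset_card_mono) auto
    \<comment> \<open>Splitting off gives the property one degree higher, so it descends.\<close>
    moreover have "cb_on (Z - Z0) (W (a + b))"
      using split(1) by (rule cb_on_Suc)
    ultimately have IH: "rank_on (Z - Z0) (W a) + rank_on (Z - Z0) (W b) \<le>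
        rank_on (Z - Z0) (W (Suc (a + b)))"
      using less.hyps fin by simp
    have ker: "rank_on Z (W d) \<le> rank_on (Z - Z0) (W d) + rank_on Z0 (K d)"
      "cfun.subspace (K d)" for d
      using rank_on_le_kernel[OF fin, of "Z - Z0" d] Z0(4) by (auto simp: K_def)
    obtain \<phi> where \<phi>: "\<And>P. P \<in> Z \<Longrightarrow> \<phi> P \<noteq> 0"
      "\<And>f. f \<in> W (a + b) \<Longrightarrow> (\<Sum>P\<in>Z. \<phi> P * f P) = 0"
      using cb_on_nowhere_zero_annihilator[OF subspace fin cb] by blast
    have "rank_on Z0 (K a) + rank_on Z0 (K b) \<le> card Z0"
    proof (rule rank_on_orthogonal)
      fix f g assume fg: "f \<in> K a" "g \<in> K b"
      \<comment> \<open>The product lies in \<open>W (a + b)\<close> and vanishes on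
        \<open>Z - Z0\<close>, so the annihilator of all of \<open>Z\<close> gives orthogonality on
        \<open>Z0\<close> alone.\<close>
      have "(\<Sum>P\<in>Z0. \<phi> P * f P * g P) = (\<Sum>P\<in>Z. \<phi> P * f P * g P)"
        using fin Z0 fg by (intro sum.mono_neutral_left) (auto simp: K_def)
      also have "\<dots> = 0"
        using \<phi>(2)[OF mult[of f a g b]] fg by (simp add: K_def mult.assoc)
      finally show "(\<Sum>P\<in>Z0. \<phi> P * f P * g P) = 0" .
    qed (use ker Z0 \<phi> in auto)
    \<comment> \<open>The kernels contribute at most \<open>card Z0\<close>, the amount that
      \<open>split(2)\<close> gains in the top degree.\<close>
    then show ?thesis
      using IH ker(1)[of a] ker(1)[of b] split(2) by linarith
  qed
qed

end

section \<open>Forms on projective space\<close>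

definition monom_val :: "('n::finite \<Rightarrow>\<^sub>0 nat) \<Rightarrow> complex ^ 'n \<Rightarrow> complex" where
  "monom_val m v = (\<Prod>k\<in>UNIV. (v $ k) ^ Poly_Mapping.lookup m k)"

lemma monom_val_add: "monom_val (m + m') v = monom_val m v * monom_val m' v"
  by (simp add: monom_val_def lookup_add power_add prod.distrib)

text \<open>A common index set allows two polynomials to be added even if terms cancel.\<close>

lemma eval_poly_superset:
  assumes "finite A" "Poly_Mapping.keys F \<subseteq> A"
  shows "eval_poly F v = (\<Sum>m\<in>A. Poly_Mapping.lookup F m * monom_val m v)"
  unfolding eval_poly_def monom_val_def
  using assms by (intro sum.mono_neutral_left) (auto simp: in_keys_iff)

lemma eval_poly_add: "eval_poly (F + G) v = eval_poly F v + eval_poly G v"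
  using eval_poly_superset[of "Poly_Mapping.keys F \<union> Poly_Mapping.keys G"] keys_add[of F G]
  by (simp add: lookup_add distrib_right sum.distrib)

lemma lookup_map_times:
  "Poly_Mapping.lookup (Poly_Mapping.map ((*) c) F) m = c * Poly_Mapping.lookup F m"
  for c :: complex
  by (simp add: map.rep_eq when_def)

lemma keys_map_times: "Poly_Mapping.keys (Poly_Mapping.map ((*) c) F) \<subseteq> Poly_Mapping.keys F"
  for c :: complex
  by (auto simp: in_keys_iff lookup_map_times)

lemma eval_poly_map_times:
  "eval_poly (Poly_Mapping.map ((*) c) F) v = c * eval_poly F v"
  using eval_poly_superset[of "Poly_Mapping.keys F"]
  by (simp add: keys_map_times lookup_map_times sum_distrib_left mult.assoc)

lemma eval_poly_single: "eval_poly (Poly_Mapping.single m c) v = c * monom_val m v"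
  using eval_poly_superset[of "{m}" "Poly_Mapping.single m c"] by (simp add: lookup_single)

definition form_funs :: "('a \<Rightarrow> complex ^ 'n) \<Rightarrow> nat \<Rightarrow> ('a \<Rightarrow> complex) set" where
  "form_funs r d = (\<lambda>F P. eval_poly F (r P)) ` forms (d :: nat)"
  for r :: "'a \<Rightarrow> complex ^ ('n::finite)"

lemma subspace_form_funs: "cfun.subspace (form_funs r d)"
  unfolding cfun.subspace_def
proof (intro conjI ballI allI)
  have "(0 :: 'b cpoly) \<in> forms d" "eval_poly (0 :: 'b cpoly) v = 0" for v
    by (auto simp: forms_def eval_poly_def)
  then show "0 \<in> form_funs r d"
    unfolding form_funs_def by (intro image_eqI[of _ _ 0]) (auto simp: fun_eq_iff)
next
  fix f g assume "f \<in> form_funs r d" "g \<in> form_funs r d"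
  then obtain F G where *: "F \<in> forms d" "G \<in> forms d"
    "f = (\<lambda>P. eval_poly F (r P))" "g = (\<lambda>P. eval_poly G (r P))"
    unfolding form_funs_def by blast
  have "F + G \<in> forms d"
    using *(1,2) keys_add[of F G] by (auto simp: forms_def)
  then show "f + g \<in> form_funs r d"
    unfolding form_funs_def
    by (intro image_eqI[of _ _ "F + G"]) (auto simp: fun_eq_iff eval_poly_add *)
next
  fix c f assume "f \<in> form_funs r d"
  then obtain F where *: "F \<in> forms d" "f = (\<lambda>P. eval_poly F (r P))"
    unfolding form_funs_def by blast
  have "Poly_Mapping.map ((*) c) F \<in> forms d"
    using *(1) keys_map_times[of c F] by (auto simp: forms_def)
  then show "(\<lambda>P. c * f P) \<in> form_funs r d"
    unfolding form_funs_def
    by (intro image_eqI[of _ _ "Poly_Mapping.map ((*) c) F"])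
      (auto simp: fun_eq_iff eval_poly_map_times *)
qed

lemma monom_val_form_funs:
  assumes "(\<Sum>k\<in>UNIV. Poly_Mapping.lookup m k) = d"
  shows "(\<lambda>P. monom_val m (r P)) \<in> form_funs r d"
  unfolding form_funs_def using assms
  by (intro image_eqI[of _ _ "Poly_Mapping.single m 1"]) (auto simp: eval_poly_single forms_def)

lemma form_funs_mult:
  assumes "f \<in> form_funs r a" "g \<in> form_funs r b"
  shows "(\<lambda>P. f P * g P) \<in> form_funs r (a + b)"
proof -
  obtain F G where *: "F \<in> forms a" "G \<in> forms b"
    "f = (\<lambda>P. eval_poly F (r P))" "g = (\<lambda>P. eval_poly G (r P))"
    using assms unfolding form_funs_def by blast
  \<comment> \<open>Expanding into monomials of degree \<open>a + b\<close> reduces the claim to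
    closure under linear combinations.\<close>
  have "(\<lambda>P. f P * g P) = (\<lambda>P. \<Sum>m\<in>Poly_Mapping.keys F. \<Sum>m'\<in>Poly_Mapping.keys G.
      (Poly_Mapping.lookup F m * Poly_Mapping.lookup G m') * monom_val (m + m') (r P))"
    unfolding * eval_poly_def monom_val_add sum_product by (simp add: monom_val_def mult_ac)
  also have "\<dots> \<in> form_funs r (a + b)"
    using *(1,2)
    by (intro subspace_sum subspace_scale subspace_form_funs monom_val_form_funs)
      (auto simp: forms_def lookup_add sum.distrib)
  finally show ?thesis .
qed

lemma coordinate_form_funs: "(\<lambda>P. r P $ k) \<in> form_funs r 1"
proof -
  have "monom_val (Poly_Mapping.single k 1) v = v $ k" for v
    by (simp add: monom_val_def lookup_single when_def if_distrib prod.delta cong: if_cong)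
  then show ?thesis
    using monom_val_form_funs[of "Poly_Mapping.single k 1" 1 r]
    by (simp add: lookup_single when_def)
qed

section \<open>Separation of points by linear forms\<close>

lemma represents_eq_line: "represents v P \<Longrightarrow> line P = vec.span {v}"
proof -
  assume v: "represents v P"
  obtain u where u: "line P = vec.span {u}"
    using line[of P] by blast
  then obtain k where k: "v = k *s u" "k \<noteq> 0"
    using v by (auto simp: represents_def vec.span_singleton)
  have "vec.span {k *s u} = vec.span {u}"
    using vec.span_image_scale[of "{u}" "\<lambda>_. k"] k(2) by simp
  then show ?thesis using u k(1) by simp
qed

text \<open>If all 2 by 2 minors vanished, dividing by a nonzero coordinate of \<open>w\<close>
  would make \<open>v\<close> a multiple of \<open>w\<close>.\<close>

lemma represents_minor:
  assumes v: "represents v P" and w: "represents w Q" and "P \<noteq> Q"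
  obtains a b where "v $ a * w $ b \<noteq> v $ b * w $ a"
proof (rule ccontr)
  assume "\<not> thesis"
  then have minors: "v $ a * w $ b = v $ b * w $ a" for a b
    using that by blast
  obtain b where b: "w $ b \<noteq> 0"
    using w by (auto simp: represents_def vec_eq_iff)
  have "v = (v $ b / w $ b) *s w"
    using b minors by (auto simp: vec_eq_iff field_simps)
  then have "v \<in> line Q"
    using represents_eq_line[OF w] by (metis vec.span_base vec.span_scale singletonI)
  then have "line P = line Q"
    using v represents_eq_line[of v] by (auto simp: represents_def)
  with \<open>P \<noteq> Q\<close> show False by (simp add: line_inject)
qed

lemma graded_functions_form_funs:
  assumes r: "\<And>P :: ('n::finite) proj. represents (r P) P"
  shows "graded_functions (form_funs r)"
proof
  fix P :: "'n proj"
  obtain k where "r P $ k \<noteq> 0"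
    using r[of P] by (auto simp: represents_def vec_eq_iff)
  then show "\<exists>l\<in>form_funs r 1. l P \<noteq> 0"
    by (intro bexI[of _ "\<lambda>P. r P $ k"] coordinate_form_funs)
next
  fix P Q :: "'n proj" assume "P \<noteq> Q"
  then obtain a b where ab: "r P $ a * r Q $ b \<noteq> r P $ b * r Q $ a"
    using represents_minor[OF r r] by metis
  \<comment> \<open>The minor with second vector \<open>r Q\<close>: zero at \<open>Q\<close> and,
    by \<open>ab\<close>, nonzero at \<open>P\<close>.\<close>
  let ?l = "\<lambda>R. r Q $ b * r R $ a - r Q $ a * r R $ b"
  have "?l \<in> form_funs r 1"
    by (intro subspace_diff subspace_scale subspace_form_funs coordinate_form_funs)
  moreover have "?l P \<noteq> 0 \<and> ?l Q = 0"
    using ab by (simp add: algebra_simps)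
  ultimately show "\<exists>l\<in>form_funs r 1. l P \<noteq> 0 \<and> l Q = 0"
    by (intro bexI[of _ ?l])
qed (auto intro: subspace_form_funs form_funs_mult)

section \<open>Telescoping and the conclusion\<close>

lemma sum_Dhilbert:
  assumes "m \<le> n + 1"
  shows "(\<Sum>k = m..n. Dhilbert Z k) = hilbert Z n - hilbert Z (m - 1)"
proof -
  \<comment> \<open>Starting the induction at \<open>m - 1\<close> makes the empty sum the base
    case.\<close>
  have "m - 1 \<le> n" using assms by simp
  then show ?thesis
  proof (induction n rule: int_ge_induct)
    case (step n)
    then have "{m..n + 1} = insert (n + 1) {m..n}" by auto
    then show ?case using step by (simp add: Dhilbert_def)
  qed simp
qed

theorem theorem4p9:
  fixes Z :: "('n::finite) proj set" and i :: nat and j :: int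
  assumes "finite Z"
    and "cayley_bacharach Z i"
    and "0 \<le> j" and "j \<le> int i + 1"
  shows "(\<Sum>k = 0..j. Dhilbert Z k) \<le> (\<Sum>k = int i + 1 - j..int i + 1. Dhilbert Z k)"
proof -
  \<comment> \<open>The same choice as in \<open>hilbert\<close>, so that the ranks agree by
    unfolding.\<close>
  define r where "r = (\<lambda>P :: 'n proj. SOME v. represents v P)"
  have r: "represents (r P) P" for P
    unfolding r_def by (rule represents_some)
  interpret graded_functions "form_funs r"
    using r by (rule graded_functions_form_funs)
  have hilbert: "hilbert Z (int d) = int (rank_on Z (form_funs r d))" for d
    by (simp add: hilbert_def eval_rank_def rank_on_def form_funs_def image_image restr_def
        eval_map_def[abs_def] r_def)
  have cb: "cb_on Z (form_funs r i)"
    using assms(2) unfolding cb_on_def cayley_bacharach_def form_funs_def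
    by (auto simp: vanishes_at_iff[OF _ r])
  \<comment> \<open>The claim after telescoping, as \<open>hilbert Z (- 1) = 0\<close>.\<close>
  have "hilbert Z j + hilbert Z (int i - j) \<le> hilbert Z (int i + 1)"
  \<comment> \<open>For \<open>j = int i + 1\<close> the second argument is -1, which is no degree
    of forms; its value 0 gives equality.\<close>
  proof (cases "j = int i + 1")
    case True
    then show ?thesis by (simp add: hilbert_def)
  next
    case False
    then have "j \<le> int i" using assms(4) by simp
    then obtain a b where ab: "j = int a" "int i - j = int b"
      using assms(3) by (metis diff_ge_0_iff_ge nonneg_int_cases)
    then have "i = a + b" by simp
    then show ?thesis
      using cb_on_rank_add_le[OF assms(1), of a b] cb hilbert[of "Suc i"]
      by (simp add: ab hilbert add.commute)
  qed
  then show ?thesis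
    using assms(3,4) by (simp add: sum_Dhilbert hilbert_def[of Z "- 1"])
qed

end
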